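(* Let $a,\nu\in\mathbb{R}$ with $\nu\ge a^2$ and $\gamma\in(0,\infty)$, and let $\operatorname{supp}(\mu_{a,\nu,\gamma})$ denote the support of $\mu_{a,\nu,\gamma}$. If $a\ge0$, then $$\max\{x:x\in\operatorname{supp}(\mu_{a,\nu,\gamma})\}\ge-\min\{x:x\in\operatorname{supp}(\mu_{a,\nu,\gamma})\},$$ and if $a\le0$, then $$\max\{x:x\in\operatorname{supp}(\mu_{a,\nu,\gamma})\}\le-\min\{x:x\in\operatorname{supp}(\mu_{a,\nu,\gamma})\}.$$
   Context: For real $a$, $\nu\ge a^2$ and $\gamma>0$, $\mu_{a,\nu,\gamma}$ is the (compactly supported) probability measure on $\mathbb{R}$ whose Stieltjes transform $m(z)=\int (x-z)^{-1}\mu_{a,\nu,\gamma}(dx)$ is, for every $z\in\mathbb{C}^+$ (the open upper half plane), the unique solution $m(z)\in\mathbb{C}^+$ of $$-\frac{1}{m(z)}=z+a\left(1-\frac{1}{1+a\gamma m(z)}\right)+\gamma(\nu-a^2)m(z).$$ (In the paper $a=\mathbb{E}[\xi k(\xi)]$ and $\nu=\mathbb{E}[k(\xi)^2]$ for a function $k$ and $\xi\sim\mathcal{N}(0,1)$, so $\nu\ge a^2$.) *)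

theory Defs
  imports "HOL-Probability.Probability"
begin

definition measure_support :: "real measure \<Rightarrow> real set" where
  "measure_support M = {x. \<forall>U. open U \<and> x \<in> U \<longrightarrow> emeasure M U > 0}"

definition stieltjes_transform :: "real measure \<Rightarrow> complex \<Rightarrow> complex" where
  "stieltjes_transform M z = (LINT x|M. 1 / (complex_of_real x - z))"

definition stieltjes_eq :: "real \<Rightarrow> real \<Rightarrow> real \<Rightarrow> complex \<Rightarrow> complex \<Rightarrow> bool" where
  "stieltjes_eq a \<nu> \<gamma> z w \<longleftrightarrow>
     - 1 / w = z + of_real a * (1 - 1 / (1 + of_real (a * \<gamma>) * w))
                 + of_real (\<gamma> * (\<nu> - a\<^sup>2)) * w"

(* For w in the upper half plane neither denominator in stieltjes_eq vanishes, so the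
   convention x / 0 = 0 plays no role below. *)

definition is_mu :: "real \<Rightarrow> real \<Rightarrow> real \<Rightarrow> real measure \<Rightarrow> bool" where
  "is_mu a \<nu> \<gamma> M \<longleftrightarrow>
     prob_space M \<and> sets M = sets borel \<and> compact (measure_support M) \<and>
     (\<forall>z. Im z > 0 \<longrightarrow>
        Im (stieltjes_transform M z) > 0 \<and> stieltjes_eq a \<nu> \<gamma> z (stieltjes_transform M z) \<and>
        (\<forall>w. Im w > 0 \<and> stieltjes_eq a \<nu> \<gamma> z w \<longrightarrow> w = stieltjes_transform M z))"

lemma measure_support_nonempty:
  assumes "prob_space M" and s: "sets M = sets borel"
  shows "measure_support M \<noteq> {}"
proof
  interpret prob_space M by fact
  assume e: "measure_support M = {}"
  define F where "F = {U. open U \<and> emeasure M U = 0}"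
  obtain F' where F': "F' \<subseteq> F" "countable F'" "\<Union>F' = \<Union>F"
    using Lindelof[of F] by (auto simp: F_def)
  have "\<exists>U\<in>F. x \<in> U" for x
  proof -
    have "x \<notin> measure_support M" using e by simp
    thus ?thesis by (auto simp: measure_support_def F_def)
  qed
  hence "\<Union>F = UNIV" by blast
  moreover have "(\<Union>U\<in>F'. U) \<in> null_sets M"
    using F' by (intro null_sets_UN' ) (auto simp: F_def null_sets_def s)
  ultimately have "UNIV \<in> null_sets M" using F' by simp
  moreover have "space M = UNIV" using sets_eq_imp_space_eq[OF s] by simp
  ultimately show False using emeasure_space_1 by (auto simp: null_sets_def)
qed

(* GREATEST and LEAST are defined by a description operator; here they are attained. *)

lemma is_mu_support_extrema:
  assumes "is_mu a \<nu> \<gamma> M"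
  defines "S \<equiv> measure_support M"
  shows "(GREATEST x. x \<in> S) \<in> S" and "\<And>y. y \<in> S \<Longrightarrow> y \<le> (GREATEST x. x \<in> S)"
    and "(LEAST x. x \<in> S) \<in> S" and "\<And>y. y \<in> S \<Longrightarrow> (LEAST x. x \<in> S) \<le> y"
proof -
  have c: "compact S" and ne: "S \<noteq> {}"
    using assms measure_support_nonempty by (auto simp: is_mu_def)
  obtain u where u: "u \<in> S" "\<And>y. y \<in> S \<Longrightarrow> y \<le> u"
    using compact_attains_sup[OF c ne] by blast
  obtain l where l: "l \<in> S" "\<And>y. y \<in> S \<Longrightarrow> l \<le> y"
    using compact_attains_inf[OF c ne] by blast
  have "(GREATEST x. x \<in> S) = u" using u by (intro Greatest_equality) auto
  thus "(GREATEST x. x \<in> S) \<in> S" "\<And>y. y \<in> S \<Longrightarrow> y \<le> (GREATEST x. x \<in> S)" using u by auto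
  have "(LEAST x. x \<in> S) = l" using l by (intro Least_equality) auto
  thus "(LEAST x. x \<in> S) \<in> S" "\<And>y. y \<in> S \<Longrightarrow> (LEAST x. x \<in> S) \<le> y" using l by auto
qed

end

(* For a >= 0 all moments of mu are nonnegative: in terms of w = 1/z, the function
   s = -m(1/w) is the generating series of the moments m_n, that is the sum of m_n w^(n+1),
   and the equation for m becomes the fixed-point equation
   s = w (1 + c s^2 + b s^2 / (1 - g s)) with b, c, g >= 0, which determines the coefficients
   recursively without ever subtracting.  (Equivalently, the free cumulants of mu are
   nonnegative.)  If the minimum of the support exceeded the maximum in modulus, high odd
   moments would be negative.  The case a <= 0 follows by reflecting mu. *)
theory Submission
  imports Defs "HOL-Complex_Analysis.Complex_Analysis"
begin

section \<open>Full mass of the support\<close>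

text \<open>The complement of the support is a union of open null sets. By Lindelof countably many
  of them have the same union, so the complement is null.\<close>

lemma AE_in_measure_support:
  assumes s: "sets M = sets borel"
  shows "AE x in M. x \<in> measure_support M"
proof -
  define F where "F = {U. open U \<and> emeasure M U = 0}"
  obtain F' where F': "F' \<subseteq> F" "countable F'" "\<Union>F' = \<Union>F"
    using Lindelof[of F] by (auto simp: F_def)
  have "(\<Union>U\<in>F'. U) \<in> null_sets M"
    using F' by (intro null_sets_UN') (auto simp: F_def null_sets_def s)
  hence "\<Union>F \<in> null_sets M" using F' by simp
  moreover have "{x \<in> space M. x \<notin> measure_support M} \<subseteq> \<Union>F"
    by (auto simp: F_def measure_support_def)
  ultimately show ?thesis by (rule AE_I')
qed

section \<open>Nonnegative coefficients of the formal fixed point\<close>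

lemma fps_mult_nth_nonneg:
  fixes F G :: "complex fps"
  assumes "\<And>i. i \<le> n \<Longrightarrow> fps_nth F i \<in> \<real>\<^sub>\<ge>\<^sub>0" "\<And>i. i \<le> n \<Longrightarrow> fps_nth G i \<in> \<real>\<^sub>\<ge>\<^sub>0" "k \<le> n"
  shows "fps_nth (F * G) k \<in> \<real>\<^sub>\<ge>\<^sub>0"
proof -
  have sum: "sum f A \<in> \<real>\<^sub>\<ge>\<^sub>0" if "\<And>i. i \<in> A \<Longrightarrow> f i \<in> \<real>\<^sub>\<ge>\<^sub>0" for f :: "nat \<Rightarrow> complex" and A
    using that by (induction A rule: infinite_finite_induct) auto
  show ?thesis unfolding fps_mult_nth using assms by (intro sum nonneg_Reals_mult_I) auto
qed

text \<open>The equation is the fixed-point equation \<open>S = X (1 + c S\<^sup>2 + b S\<^sup>2 / (1 - g S))\<close>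
  with the denominator cleared.\<close>

lemma fps_solution_nonneg:
  fixes G :: "complex fps" and b c g :: real
  defines "S \<equiv> fps_X * G"
  assumes nn: "b \<ge> 0" "c \<ge> 0" "g \<ge> 0"
    and eq: "S * (1 - fps_const (of_real g) * S) =
      fps_X * ((1 - fps_const (of_real g) * S) * (1 + fps_const (of_real c) * S * S) + fps_const (of_real b) * S * S)"
  shows "fps_nth G n \<in> \<real>\<^sub>\<ge>\<^sub>0"
proof -
  \<comment> \<open>The factor \<open>fps_X\<close> in \<open>S\<close> gives \<open>D\<close>
    constant term 1, so \<open>D\<close> has an inverse \<open>U\<close>. With \<open>V\<close> the
    bracket of the fixed-point equation, that equation becomes \<open>S = fps_X * V\<close>.\<close>
  define D where "D = 1 - fps_const (of_real g) * S"
  define U where "U = inverse D"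
  define V where "V = 1 + fps_const (of_real c) * (S * S) + fps_const (of_real b) * (S * S * U)"
  have D0: "fps_nth D 0 = 1" by (simp add: D_def S_def)
  have DU: "D * U = 1" using D0 unfolding U_def by (subst mult.commute, intro inverse_mult_eq_1) auto
  have "S = S * D * U" using DU by (simp add: mult.assoc)
  also have "\<dots> = fps_X * (D * (1 + fps_const (of_real c) * S * S) + fps_const (of_real b) * S * S) * U"
    using eq by (simp add: D_def)
  also have "\<dots> = fps_X * ((D * U) * (1 + fps_const (of_real c) * S * S) + fps_const (of_real b) * S * S * U)"
    by (simp add: algebra_simps)
  also have "\<dots> = fps_X * V" by (simp add: DU V_def mult.assoc)
  finally have SV: "S = fps_X * V" .
  hence GV: "G = V" by (simp add: S_def)
  have "U = D * U + fps_const (of_real g) * S * U" by (simp add: D_def algebra_simps)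
  also have "\<dots> = 1 + fps_X * (fps_const (of_real g) * (V * U))" by (simp add: DU SV algebra_simps)
  finally have UV: "U = 1 + fps_X * (fps_const (of_real g) * (V * U))" .
  \<comment> \<open>The factor \<open>fps_X\<close> shifts indices by one: \<open>V\<close> up to
    index n needs only \<open>S\<close> and \<open>U\<close> up to n, while \<open>S\<close> and
    \<open>U\<close> at n + 1 need only \<open>V\<close> and \<open>U\<close> up to n. This makes
    the induction on n go through.\<close>
  have S0: "fps_nth S 0 = 0" and SSuc: "fps_nth S (Suc k) = fps_nth V k" for k
    by (auto simp: SV)
  have U0: "fps_nth U 0 = 1" and USuc: "fps_nth U (Suc k) = of_real g * fps_nth (V * U) k" for k
    by (subst UV, simp)+
  have Vpos: "\<forall>k\<le>n. fps_nth V k \<in> \<real>\<^sub>\<ge>\<^sub>0"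
    if "\<forall>k\<le>n. fps_nth S k \<in> \<real>\<^sub>\<ge>\<^sub>0 \<and> fps_nth U k \<in> \<real>\<^sub>\<ge>\<^sub>0" for n
  proof (intro allI impI)
    fix k assume k: "k \<le> n"
    have 1: "fps_nth (S * S) i \<in> \<real>\<^sub>\<ge>\<^sub>0" if "i \<le> n" for i
      using \<open>\<forall>k\<le>n. _\<close> that by (intro fps_mult_nth_nonneg[of n]) auto
    have 2: "fps_nth (S * S * U) k \<in> \<real>\<^sub>\<ge>\<^sub>0"
      using \<open>\<forall>k\<le>n. _\<close> 1 k by (intro fps_mult_nth_nonneg[of n]) auto
    show "fps_nth V k \<in> \<real>\<^sub>\<ge>\<^sub>0"
      using 1[OF k] 2 nn by (auto simp: V_def intro!: nonneg_Reals_add_I nonneg_Reals_mult_I)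
  qed
  have "\<forall>k\<le>n. fps_nth S k \<in> \<real>\<^sub>\<ge>\<^sub>0 \<and> fps_nth U k \<in> \<real>\<^sub>\<ge>\<^sub>0" for n
  proof (induction n)
    case 0 thus ?case by (simp add: S0 U0)
  next
    case (Suc n)
    note V = Vpos[OF Suc]
    have "fps_nth (V * U) n \<in> \<real>\<^sub>\<ge>\<^sub>0"
      using V Suc by (intro fps_mult_nth_nonneg[of n]) auto
    with Suc V nn show ?case by (auto simp: le_Suc_eq SSuc USuc)
  qed
  from Vpos[OF this[of n]] show ?thesis by (simp add: GV)
qed

section \<open>From the equation on a half plane to the moments\<close>

text \<open>Identity theorem: a function with an expansion at 0 is holomorphic on a ball around 0,
  and this ball meets the lower half plane in a nonempty open set. This allows an equation known
  only off the real axis to be read off as one between power series at 0.\<close>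

lemma fps_eq_0_if_zero_on_lower_half_plane:
  fixes f :: "complex \<Rightarrow> complex"
  assumes f: "f has_fps_expansion F" and z: "\<And>w. Im w < 0 \<Longrightarrow> f w = 0"
  shows "F = 0"
proof -
  obtain s where s: "open s" "0 \<in> s" "f holomorphic_on s"
    using has_fps_expansion_imp_holomorphic[OF f] by metis
  obtain r where r: "r > 0" "ball 0 r \<subseteq> s" using s open_contains_ball by blast
  have "f w = 0" if "w \<in> ball 0 r" for w
  proof (rule analytic_continuation_open[where f = f and g = "\<lambda>_. 0" and s' = "ball 0 r"
        and s = "ball 0 r \<inter> {w. Im w < 0}"])
    show "open (ball 0 r \<inter> {w. Im w < 0})"
      by (intro open_Int open_ball open_halfspace_Im_lt)
    have "- (of_real (r/2) * \<i>) \<in> ball 0 r \<inter> {w. Im w < 0}"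
      using r by (auto simp: norm_mult)
    thus "ball 0 r \<inter> {w. Im w < 0} \<noteq> {}" by blast
    show "f holomorphic_on ball 0 r" using s r by (auto intro: holomorphic_on_subset)
  qed (use that z in auto)
  hence "eventually (\<lambda>w. f w = 0) (nhds 0)"
    using r by (auto simp: eventually_nhds intro!: exI[of _ "ball 0 r"])
  hence "f has_fps_expansion 0" by (simp add: has_fps_expansion_0_iff)
  thus ?thesis using fps_expansion_unique_complex f by blast
qed

text \<open>The geometric series in \<open>w * x\<close> is integrated term by term; for small
  \<open>w\<close> the bound on \<open>x\<close> dominates it by a convergent geometric series of
  constants.\<close>

lemma moment_generating_fps:
  fixes M :: "real measure"
  assumes "prob_space M" and s: "sets M = sets borel" and b: "AE x in M. \<bar>x\<bar> \<le> R"
  shows "(\<lambda>w. LINT x|M. 1 / (1 - w * complex_of_real x)) has_fps_expansion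
    Abs_fps (\<lambda>n. complex_of_real (LINT x|M. x ^ n))"
proof (rule has_fps_expansionI)
  interpret prob_space M by fact
  \<comment> \<open>The maximum with 1 keeps the radius \<open>1 / R'\<close> positive even if
    \<open>R\<close> is 0, as it may be for the point mass at 0.\<close>
  define R' where "R' = max R 1"
  have R': "R' > 0" by (simp add: R'_def)
  have bR: "AE x in M. \<bar>x\<bar> \<le> R'" using b by eventually_elim (auto simp: R'_def)
  note [measurable_cong] = s
  have main: "(\<lambda>n. complex_of_real (LINT x|M. x ^ n) * w ^ n) sums (LINT x|M. 1 / (1 - w * complex_of_real x))"
    if w: "norm w < 1 / R'" for w
  proof -
    have q: "norm w * R' < 1" using w R' by (simp add: field_simps)
    have bnd: "AE x in M. norm (w * complex_of_real x) \<le> norm w * R'"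
      using bR by eventually_elim (auto simp: norm_mult intro: mult_left_mono)
    have bn: "AE x in M. norm ((w * complex_of_real x) ^ n) \<le> (norm w * R') ^ n" for n
      using bnd by eventually_elim (auto simp: norm_power intro: power_mono)
    have int: "integrable M (\<lambda>x. (w * complex_of_real x) ^ n)" for n
      by (rule integrable_const_bound[OF bn]) measurable
    have "(\<lambda>n. LINT x|M. (w * complex_of_real x) ^ n) sums (LINT x|M. (\<Sum>n. (w * complex_of_real x) ^ n))"
    proof (rule sums_integral[OF int])
      show "AE x in M. summable (\<lambda>n. norm ((w * complex_of_real x) ^ n))"
        using bnd by eventually_elim (use q in \<open>auto simp: norm_power intro: summable_geometric\<close>)
      have le: "(LINT x|M. norm ((w * complex_of_real x) ^ n)) \<le> (norm w * R') ^ n" for n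
        using integral_mono_AE[OF integrable_norm[OF int] integrable_const bn[of n]] by (simp add: prob_space)
      show "summable (\<lambda>n. LINT x|M. norm ((w * complex_of_real x) ^ n))"
        using q R' le by (intro summable_comparison_test'[OF summable_geometric, of "norm w * R'" 0]) auto
    qed
    also have "(LINT x|M. (\<Sum>n. (w * complex_of_real x) ^ n)) = (LINT x|M. 1 / (1 - w * complex_of_real x))"
    proof (rule integral_cong_AE)
      show "AE x in M. (\<Sum>n. (w * complex_of_real x) ^ n) = 1 / (1 - w * complex_of_real x)"
        using bnd by eventually_elim (use q in \<open>auto intro: suminf_geometric\<close>)
    qed measurable
    also have "(\<lambda>n. LINT x|M. (w * complex_of_real x) ^ n) = (\<lambda>n. complex_of_real (LINT x|M. x ^ n) * w ^ n)"
      unfolding integral_complex_of_real[symmetric]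
      by (auto simp: power_mult_distrib mult.commute simp del: integral_complex_of_real)
    finally show ?thesis .
  qed
  show "\<forall>\<^sub>F u in nhds 0. (\<lambda>n. fps_nth (Abs_fps (\<lambda>n. complex_of_real (LINT x|M. x ^ n))) n * u ^ n) sums
      (LINT x|M. 1 / (1 - u * complex_of_real x))"
    unfolding eventually_nhds using R' main by (intro exI[of _ "ball 0 (1 / R')"]) auto
qed

lemma is_mu_support_bounded:
  assumes "is_mu a \<nu> \<gamma> M"
  obtains R where "AE x in M. \<bar>x\<bar> \<le> R"
proof -
  have "bounded (measure_support M)" and s: "sets M = sets borel"
    using assms by (auto simp: is_mu_def compact_imp_bounded)
  then obtain R where "\<And>x. x \<in> measure_support M \<Longrightarrow> \<bar>x\<bar> \<le> R"
    by (auto simp: bounded_iff)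
  thus ?thesis using that AE_in_measure_support[OF s] by (metis (mono_tags, lifting) AE_mp AE_I2)
qed

lemma is_mu_moments_nonneg:
  fixes a \<nu> \<gamma> :: real
  assumes \<nu>: "\<nu> \<ge> a\<^sup>2" and \<gamma>: "\<gamma> > 0" and a: "a \<ge> 0" and mu: "is_mu a \<nu> \<gamma> M"
  shows "(LINT x|M. x ^ n) \<ge> 0"
proof -
  define G where "G = Abs_fps (\<lambda>n. complex_of_real (LINT x|M. x ^ n))"
  define h where "h = (\<lambda>w. LINT x|M. 1 / (1 - w * complex_of_real x))"
  define b c g where "b = a\<^sup>2 * \<gamma>" and "c = \<gamma> * (\<nu> - a\<^sup>2)" and "g = a * \<gamma>"
  obtain R where R: "AE x in M. \<bar>x\<bar> \<le> R" using is_mu_support_bounded[OF mu] .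
  have h: "h has_fps_expansion G"
    unfolding h_def G_def using mu R by (intro moment_generating_fps) (auto simp: is_mu_def)
  \<comment> \<open>Clearing the denominators makes the equation polynomial in \<open>w\<close> and
    \<open>s\<close>, so that it can be evaluated both at numbers and at power series.\<close>
  define P where "P = (\<lambda>w s :: complex. s * (1 - of_real g * s) -
     w * ((1 - of_real g * s) * (1 + of_real c * s * s) + of_real b * s * s))"
  have P0: "P w (w * h w) = 0" if w: "Im w < 0" for w
  proof -
    define s where "s = w * h w"
    have w0: "w \<noteq> 0" using w by auto
    \<comment> \<open>Inversion sends the lower half plane to the upper one, where the equation for
      the transform is available.\<close>
    have z: "Im (1 / w) > 0" using w by (simp add: Im_complex_div_gt_0)
    have m: "stieltjes_transform M (1 / w) = - s"
    proof -
      have eq: "1 / (complex_of_real x - 1 / w) = - w * (1 / (1 - w * complex_of_real x))" for x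
        using w0 by (simp add: divide_simps) (auto simp: algebra_simps)
      show ?thesis unfolding stieltjes_transform_def s_def h_def eq
        by (subst integral_mult_right_zero) simp
    qed
    have "Im (- s) > 0" and eq: "stieltjes_eq a \<nu> \<gamma> (1 / w) (- s)"
      using mu[unfolded is_mu_def, THEN conjunct2, THEN conjunct2, THEN conjunct2, rule_format, OF z]
      unfolding m by blast+
    define D where "D = 1 - of_real g * s"
    have s0: "s \<noteq> 0" using \<open>Im (- s) > 0\<close> by auto
    \<comment> \<open>\<open>s\<close> is not real, so a real multiple of it cannot equal 1.\<close>
    have D0: "D \<noteq> 0"
    proof
      assume "D = 0"
      hence 1: "of_real g * s = 1" by (simp add: D_def)
      have "Im (of_real g * s) = 0" unfolding 1 by simp
      hence "g = 0" using \<open>Im (- s) > 0\<close> by auto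
      with 1 show False by simp
    qed
    have "1 / s = 1 / w + of_real a * (1 - 1 / D) - of_real c * s"
      using eq by (simp add: stieltjes_eq_def D_def c_def g_def)
    hence "w * D = s * D + of_real a * s * w * (D - 1) - of_real c * s * s * w * D"
      using s0 w0 D0 by (simp add: field_simps)
    \<comment> \<open>This explains the choice of \<open>b\<close>: it is \<open>a * g\<close>, and
      \<open>D - 1 = - g * s\<close>.\<close>
    moreover have "of_real a * s * w * (D - 1) = - (of_real b * s * s * w)"
      by (simp add: D_def b_def g_def power2_eq_square)
    ultimately have "s * D = w * (D * (1 + of_real c * s * s) + of_real b * s * s)"
      by algebra
    thus ?thesis unfolding P_def s_def[symmetric] D_def[symmetric] by simp
  qed
  define S where "S = fps_X * G"
  have "(\<lambda>w. P w (w * h w)) has_fps_expansion (S * (1 - fps_const (of_real g) * S) -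
      fps_X * ((1 - fps_const (of_real g) * S) * (1 + fps_const (of_real c) * S * S) + fps_const (of_real b) * S * S))"
    unfolding P_def S_def by (intro fps_expansion_intros h)
  from fps_eq_0_if_zero_on_lower_half_plane[OF this P0]
  have "S * (1 - fps_const (of_real g) * S) =
      fps_X * ((1 - fps_const (of_real g) * S) * (1 + fps_const (of_real c) * S * S) + fps_const (of_real b) * S * S)"
    by simp
  \<comment> \<open>The sign of \<open>a\<close> enters through \<open>g\<close>; \<open>b\<close>
    contains the square of \<open>a\<close>, and \<open>c\<close> is nonnegative because \<nu> is at
    least that square.\<close>
  moreover have "b \<ge> 0" "c \<ge> 0" "g \<ge> 0" using \<nu> \<gamma> a by (auto simp: b_def c_def g_def)
  ultimately have "fps_nth G n \<in> \<real>\<^sub>\<ge>\<^sub>0" unfolding S_def by (intro fps_solution_nonneg)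
  thus ?thesis by (simp add: G_def)
qed

section \<open>From odd moments to the extremes of the support\<close>

text \<open>Otherwise some \<open>r\<close> lies strictly between \<open>max B 0\<close> and
  \<open>- A\<close>, and a mass p > 0 sits below \<open>- r\<close>. It contributes at most
  \<open>- p * r ^ n\<close> to an odd moment, which the rest, at most \<open>(max B 0) ^ n\<close>,
  cannot offset for large n.\<close>

lemma max_ge_neg_min_if_odd_moments_nonneg:
  fixes M :: "real measure" and A B :: real
  assumes "prob_space M" and s: "sets M = sets borel"
    and odd: "\<And>k. (LINT x|M. x ^ (2 * k + 1)) \<ge> 0"
    and A: "A \<in> measure_support M"
    and AB: "\<And>y. y \<in> measure_support M \<Longrightarrow> A \<le> y \<and> y \<le> B"
  shows "B \<ge> - A"
proof (rule ccontr)
  assume "\<not> B \<ge> - A"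
  \<comment> \<open>\<open>A \<le> B\<close> and \<open>B < - A\<close> force \<open>A < 0\<close>,
    so 0 lies below \<open>- A\<close> as well.\<close>
  hence neg: "max B 0 < - A" using A AB by (force simp: not_le)
  interpret prob_space M by fact
  note [measurable_cong] = s
  \<comment> \<open>Replacing \<open>B\<close> by a nonnegative bound makes \<open>r\<close>
    positive, keeps the powers of \<open>b\<close> nonnegative and puts \<open>b / r\<close> in the
    interval from 0 to 1, with 1 excluded.\<close>
  define b where "b = max B 0"
  obtain r where r: "b < r" "r < - A" using neg dense unfolding b_def by blast
  have r0: "r > 0" "b \<ge> 0" using r by (auto simp: b_def)
  define p where "p = measure M {..<-r}"
  \<comment> \<open>This half-line is an open neighbourhood of the support point
    \<open>A\<close>.\<close>
  have "emeasure M {..<-r} > 0" using A r unfolding measure_support_def by auto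
  hence p: "p > 0" unfolding p_def by (simp add: emeasure_eq_measure)
  have ae: "AE x in M. A \<le> x \<and> x \<le> B" using AE_in_measure_support[OF s] by eventually_elim (use AB in auto)
  have "p \<le> (b / r) ^ (2 * k + 1)" for k
  proof -
    let ?n = "2 * k + 1"
    \<comment> \<open>Integrating this bound gives \<open>0 \<le> b\<^sup>n - r\<^sup>n p\<close> for odd \<open>n\<close>.\<close>
    have le: "AE x in M. x ^ ?n \<le> b ^ ?n - r ^ ?n * indicator {..<-r} x"
      using ae
    proof eventually_elim
      case (elim x)
      show ?case
      proof (cases "x < - r")
        case True
        hence "x ^ ?n \<le> (- r) ^ ?n" by (intro power_mono_odd) auto
        moreover have "(- r) ^ ?n = - (r ^ ?n)" by (intro power_minus_odd) auto
        moreover have "b ^ ?n \<ge> 0" using r0 by (intro zero_le_power)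
        ultimately have "x ^ ?n \<le> b ^ ?n - r ^ ?n" by linarith
        thus ?thesis using True by simp
      next
        case False
        have "x ^ ?n \<le> b ^ ?n" using elim by (intro power_mono_odd) (auto simp: b_def)
        thus ?thesis using False by simp
      qed
    qed
    have i1: "integrable M (\<lambda>x. x ^ ?n)"
    proof (rule integrable_const_bound)
      show "AE x in M. norm (x ^ ?n) \<le> (\<bar>A\<bar> + \<bar>B\<bar>) ^ ?n"
        using ae by eventually_elim (unfold norm_power, intro power_mono, auto)
    qed measurable
    have i2: "integrable M (\<lambda>x. r ^ ?n * indicator {..<-r} x :: real)"
      by (intro integrable_mult_right integrable_real_indicator) (auto simp: s emeasure_eq_measure)
    have "0 \<le> (LINT x|M. x ^ ?n)" by (rule odd)
    also have "\<dots> \<le> (LINT x|M. b ^ ?n - r ^ ?n * indicator {..<-r} x)"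
      using i1 i2 le by (intro integral_mono_AE Bochner_Integration.integrable_diff) auto
    also have "\<dots> = b ^ ?n - r ^ ?n * p"
      using i2 by (subst Bochner_Integration.integral_diff) (auto simp: prob_space p_def s)
    finally have "r ^ ?n * p \<le> b ^ ?n" by simp
    thus "p \<le> (b / r) ^ ?n" using r0 by (simp add: power_divide pos_le_divide_eq mult.commute del: power_Suc)
  qed
  moreover have "(\<lambda>k. (b / r) ^ (2 * k + 1)) \<longlonglongrightarrow> 0"
    using r r0 by (intro LIMSEQ_power_zero[THEN LIMSEQ_subseq_LIMSEQ, unfolded o_def] strict_monoI) auto
  ultimately have "p \<le> 0" by (intro LIMSEQ_le_const) auto
  with p show False by simp
qed

section \<open>Reflection of the measure at the origin\<close>

lemma measure_support_uminus:
  fixes M :: "real measure"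
  assumes s: "sets M = sets borel"
  shows "x \<in> measure_support (distr M borel uminus) \<longleftrightarrow> - x \<in> measure_support M"
proof -
  note [measurable_cong] = s
  have sp: "space M = UNIV" using sets_eq_imp_space_eq[OF s] by simp
  have em: "emeasure (distr M borel uminus) U = emeasure M (uminus ` U)" if "open U" for U :: "real set"
  proof -
    have "uminus -` U = uminus ` U" by (force simp: image_iff)
    thus ?thesis using that by (subst emeasure_distr) (auto simp: sp)
  qed
  have "(\<forall>U. open U \<and> x \<in> U \<longrightarrow> emeasure M (uminus ` U) > 0) \<longleftrightarrow> (\<forall>U. open U \<and> - x \<in> U \<longrightarrow> emeasure M U > 0)"
  proof safe
    fix U assume *: "\<forall>U. open U \<and> x \<in> U \<longrightarrow> emeasure M (uminus ` U) > 0" "open U" "- x \<in> U"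
    have "open (uminus ` U)" "x \<in> uminus ` U" using * open_negations[of U] by (force simp: image_iff)+
    from *(1)[rule_format, OF conjI, OF this] show "emeasure M U > 0" by (simp add: image_image)
  next
    fix U assume *: "\<forall>U. open U \<and> - x \<in> U \<longrightarrow> emeasure M U > 0" "open U" "x \<in> U"
    thus "emeasure M (uminus ` U) > 0" using open_negations[of U] by auto
  qed
  thus ?thesis by (auto simp: measure_support_def em)
qed

text \<open>Negating and conjugating both sides turns one equation into the other: \<open>a\<close>
  changes sign in both of its odd occurrences, while its square stays. The map from z to
  \<open>- cnj z\<close> preserves the upper half plane.\<close>

lemma stieltjes_eq_reflect:
  "stieltjes_eq (- a) \<nu> \<gamma> z w \<longleftrightarrow> stieltjes_eq a \<nu> \<gamma> (- cnj z) (- cnj w)"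
proof -
  have "stieltjes_eq a \<nu> \<gamma> (- cnj z) (- cnj w) \<longleftrightarrow>
    cnj (- (- 1 / (- cnj w))) = cnj (- (- cnj z + of_real a * (1 - 1 / (1 + of_real (a * \<gamma>) * (- cnj w)))
                 + of_real (\<gamma> * (\<nu> - a\<^sup>2)) * (- cnj w)))"
    by (simp only: stieltjes_eq_def complex_cnj_cancel_iff neg_equal_iff_equal)
  also have "\<dots> \<longleftrightarrow> stieltjes_eq (- a) \<nu> \<gamma> z w"
    by (simp add: stieltjes_eq_def algebra_simps)
  finally show ?thesis by simp
qed

text \<open>The transform of the reflected measure at z is \<open>- cnj\<close> of the original
  transform at \<open>- cnj z\<close>, so existence and uniqueness of the solution carry over
  through the symmetry of the equation.\<close>

lemma is_mu_reflect:
  assumes mu: "is_mu a \<nu> \<gamma> M"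
  shows "is_mu (- a) \<nu> \<gamma> (distr M borel uminus)"
proof -
  have s: "sets M = sets borel" using mu by (simp add: is_mu_def)
  note [measurable_cong] = s
  interpret prob_space M using mu by (simp add: is_mu_def)
  let ?N = "distr M borel uminus"
  have st: "stieltjes_transform ?N z = - cnj (stieltjes_transform M (- cnj z))" for z
  proof -
    have "stieltjes_transform ?N z = (LINT x|M. 1 / (complex_of_real (- x) - z))"
      unfolding stieltjes_transform_def by (subst integral_distr) auto
    also have "\<dots> = (LINT x|M. - cnj (1 / (complex_of_real x - (- cnj z))))"
    proof (rule Bochner_Integration.integral_cong[OF refl])
      fix x
      have "complex_of_real (- x) - z = - (complex_of_real x + z)" by simp
      thus "1 / (complex_of_real (- x) - z) = - cnj (1 / (complex_of_real x - (- cnj z)))"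
        by (simp only: minus_divide_right[symmetric]) simp
    qed
    also have "\<dots> = - cnj (stieltjes_transform M (- cnj z))"
      unfolding stieltjes_transform_def by (simp only: integral_minus Bochner_Integration.integral_cnj)
    finally show ?thesis .
  qed
  have supp: "measure_support ?N = uminus ` measure_support M"
    using measure_support_uminus[OF s] by (force simp: image_iff)
  have "compact (measure_support ?N)"
    unfolding supp using mu by (intro compact_negations) (simp add: is_mu_def)
  moreover have "prob_space ?N" by (rule prob_space_distr) simp
  moreover have "Im (stieltjes_transform ?N z) > 0 \<and> stieltjes_eq (- a) \<nu> \<gamma> z (stieltjes_transform ?N z) \<and>
        (\<forall>w. Im w > 0 \<and> stieltjes_eq (- a) \<nu> \<gamma> z w \<longrightarrow> w = stieltjes_transform ?N z)"
    if z: "Im z > 0" for z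
  proof -
    have z': "Im (- cnj z) > 0" using z by simp
    note m = mu[unfolded is_mu_def, THEN conjunct2, THEN conjunct2, THEN conjunct2, rule_format, OF z']
    \<comment> \<open>A competitor \<open>w\<close> reflects to the solution \<open>- cnj w\<close>
      of the original equation at \<open>- cnj z\<close>, where uniqueness is known.\<close>
    have "w = stieltjes_transform ?N z" if "Im w > 0" "stieltjes_eq (- a) \<nu> \<gamma> z w" for w
    proof -
      have "- cnj w = stieltjes_transform M (- cnj z)"
        using m that by (simp add: stieltjes_eq_reflect)
      from this[symmetric] show ?thesis by (simp add: st)
    qed
    thus ?thesis using m by (simp add: stieltjes_eq_reflect st)
  qed
  ultimately show ?thesis by (simp add: is_mu_def)
qed

section \<open>Comparison of the extremes for both signs of \<open>a\<close>\<close>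

lemma is_mu_max_ge_neg_min:
  fixes a \<nu> \<gamma> :: real
  assumes "\<nu> \<ge> a\<^sup>2" and "\<gamma> > 0" and "a \<ge> 0" and mu: "is_mu a \<nu> \<gamma> M"
  shows "(GREATEST x. x \<in> measure_support M) \<ge> - (LEAST x. x \<in> measure_support M)"
  using mu
  by (intro max_ge_neg_min_if_odd_moments_nonneg[of M] conjI is_mu_moments_nonneg[OF assms]
      is_mu_support_extrema[OF mu]) (auto simp: is_mu_def)

theorem proposition1p3:
  fixes a \<nu> \<gamma> :: real and M :: "real measure"
  assumes "\<nu> \<ge> a\<^sup>2" and "\<gamma> > 0" and "is_mu a \<nu> \<gamma> M"
  shows "(a \<ge> 0 \<longrightarrow> (GREATEST x. x \<in> measure_support M) \<ge> - (LEAST x. x \<in> measure_support M)) \<and>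
         (a \<le> 0 \<longrightarrow> (GREATEST x. x \<in> measure_support M) \<le> - (LEAST x. x \<in> measure_support M))"
proof (intro conjI impI)
  assume "a \<ge> 0"
  thus "(GREATEST x. x \<in> measure_support M) \<ge> - (LEAST x. x \<in> measure_support M)"
    using assms by (intro is_mu_max_ge_neg_min)
next
  assume "a \<le> 0"
  let ?N = "distr M borel uminus"
  have N: "is_mu (- a) \<nu> \<gamma> ?N" using assms(3) by (rule is_mu_reflect)
  have supp: "x \<in> measure_support ?N \<longleftrightarrow> - x \<in> measure_support M" for x
    using assms(3) by (intro measure_support_uminus) (simp add: is_mu_def)
  note E = is_mu_support_extrema[OF assms(3)]
  \<comment> \<open>Reflection swaps the two extremes and their signs, so the inequality for
    \<open>?N\<close>, whose parameter \<open>- a\<close> is nonnegative, is the reversed inequality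
    for \<open>M\<close>.\<close>
  have "(GREATEST x. x \<in> measure_support ?N) = - (LEAST x. x \<in> measure_support M)"
    using E by (intro Greatest_equality) (force simp: supp)+
  moreover have "(LEAST x. x \<in> measure_support ?N) = - (GREATEST x. x \<in> measure_support M)"
    using E by (intro Least_equality) (force simp: supp)+
  moreover have "(GREATEST x. x \<in> measure_support ?N) \<ge> - (LEAST x. x \<in> measure_support ?N)"
    using assms N \<open>a \<le> 0\<close> by (intro is_mu_max_ge_neg_min[of "- a" \<nu> \<gamma>]) auto
  ultimately show "(GREATEST x. x \<in> measure_support M) \<le> - (LEAST x. x \<in> measure_support M)"
    by simp
qed

end
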